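(* Let $G$ be a cop-win graph on $n\geq 7$ vertices, let $Z\subseteq V(G)$ be the set of vertices $v$ such that a single cop starting at $v$ can guarantee capturing a single robber (who chooses his start after the cop) by round $n-4$, and let $$d_Z=\max\{d(x,Z)\mid x\in N[u],\ u\in V(G)\text{ is a trap}\}.$$ Then for every $m\geq 1$, $\mathrm{capt}(G,m)\leq d_Z(m-1)+m(n-4)$.
   Context: All graphs are finite, simple, connected and reflexive (every vertex is considered adjacent to itself, so a player may stay in place). The game of $k$ cops and $m$ robbers on $G$: in round 0 the cops first choose starting vertices, then the robbers choose theirs. In each round $i\geq 1$, all $k$ cops move (each to an adjacent vertex or staying), then all $m$ robbers move likewise. Several players may occupy the same vertex. Whenever a cop and some robbers occupy the same vertex, those robbers are captured and take no further part in the game. Both sides have full information. The cops win if all robbers are captured after finitely many rounds. $G$ is $k$-cop-win if $k$ cops can always win against one robber (cop-win means $1$-cop-win). For a $k$-cop-win graph $G$ and $\ell\geq k$, $\mathrm{capt}_\ell(G,m)$ is the index of the round in which the last robber is captured when $\ell$ cops play to minimize this index and $m$ robbers play to maximize it; $\mathrm{capt}(G,m)=\mathrm{capt}_1(G,m)$. A vertex $u$ is a trap if $N[u]\subseteq N[v]$ for some vertex $v\neq u$. $d(x,Z)=\min_{z\in Z}d(x,z)$. (It is known that every cop-win graph on $n\geq 7$ vertices has capture time at most $n-4$ against one robber, so $Z\neq\emptyset$.) *)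

theory Defs
  imports Main
begin

text \<open>A graph is given by a vertex set V and an edge predicate E (simple: symmetric,
  irreflexive, edges inside V). Adjacency is taken reflexively.\<close>

definition simple_graph :: "'a set \<Rightarrow> ('a \<Rightarrow> 'a \<Rightarrow> bool) \<Rightarrow> bool" where
  "simple_graph V E \<longleftrightarrow> finite V \<and> (\<forall>u v. E u v \<longrightarrow> u \<in> V \<and> v \<in> V)
     \<and> (\<forall>u v. E u v \<longrightarrow> E v u) \<and> (\<forall>u. \<not> E u u)"

definition connected_graph :: "'a set \<Rightarrow> ('a \<Rightarrow> 'a \<Rightarrow> bool) \<Rightarrow> bool" where
  "connected_graph V E \<longleftrightarrow> V \<noteq> {} \<and> (\<forall>u\<in>V. \<forall>v\<in>V. (u, v) \<in> {(x, y). E x y}\<^sup>*)"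

definition adj :: "'a set \<Rightarrow> ('a \<Rightarrow> 'a \<Rightarrow> bool) \<Rightarrow> 'a \<Rightarrow> 'a \<Rightarrow> bool" where
  "adj V E u v \<longleftrightarrow> u \<in> V \<and> v \<in> V \<and> (u = v \<or> E u v)"

definition cnbhd :: "'a set \<Rightarrow> ('a \<Rightarrow> 'a \<Rightarrow> bool) \<Rightarrow> 'a \<Rightarrow> 'a set" where
  "cnbhd V E u = {v. adj V E u v}"

definition trap :: "'a set \<Rightarrow> ('a \<Rightarrow> 'a \<Rightarrow> bool) \<Rightarrow> 'a \<Rightarrow> bool" where
  "trap V E u \<longleftrightarrow> u \<in> V \<and> (\<exists>v\<in>V. v \<noteq> u \<and> cnbhd V E u \<subseteq> cnbhd V E v)"

definition graph_dist :: "'a set \<Rightarrow> ('a \<Rightarrow> 'a \<Rightarrow> bool) \<Rightarrow> 'a \<Rightarrow> 'a \<Rightarrow> nat" where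
  "graph_dist V E x y = (LEAST k. (x, y) \<in> {(u, v). adj V E u v} ^^ k)"

definition set_dist :: "'a set \<Rightarrow> ('a \<Rightarrow> 'a \<Rightarrow> bool) \<Rightarrow> 'a \<Rightarrow> 'a set \<Rightarrow> nat" where
  "set_dist V E x Z = Min (graph_dist V E x ` Z)"

text \<open>Game states: cop positions as a list (one entry per cop); robber positions as a list
  of options (None = captured).\<close>

definition capture :: "'a list \<Rightarrow> 'a option list \<Rightarrow> 'a option list" where
  "capture C R = map (\<lambda>r. case r of None \<Rightarrow> None | Some x \<Rightarrow> if x \<in> set C then None else Some x) R"

definition all_captured :: "'a option list \<Rightarrow> bool" where
  "all_captured R \<longleftrightarrow> (\<forall>r\<in>set R. r = None)"

definition cop_moves :: "'a set \<Rightarrow> ('a \<Rightarrow> 'a \<Rightarrow> bool) \<Rightarrow> 'a list \<Rightarrow> 'a list \<Rightarrow> bool" where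
  "cop_moves V E C C' \<longleftrightarrow> length C' = length C \<and> (\<forall>i<length C. adj V E (C ! i) (C' ! i))"

definition robber_moves :: "'a set \<Rightarrow> ('a \<Rightarrow> 'a \<Rightarrow> bool) \<Rightarrow> 'a option list \<Rightarrow> 'a option list \<Rightarrow> bool" where
  "robber_moves V E R R' \<longleftrightarrow> length R' = length R \<and>
     (\<forall>i<length R. (R ! i = None \<longrightarrow> R' ! i = None) \<and>
                   (\<forall>x. R ! i = Some x \<longrightarrow> (\<exists>y. R' ! i = Some y \<and> adj V E x y)))"

text \<open>cops_win_within V E t C R: from the position reached at the end of a round
  (cops at C, active robbers R, captures already performed), the cops can force that all
  robbers are captured within the next t rounds.\<close>

fun cops_win_within :: "'a set \<Rightarrow> ('a \<Rightarrow> 'a \<Rightarrow> bool) \<Rightarrow> nat \<Rightarrow> 'a list \<Rightarrow> 'a option list \<Rightarrow> bool" where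
  "cops_win_within V E 0 C R = all_captured R"
| "cops_win_within V E (Suc t) C R =
     (all_captured R \<or>
      (\<exists>C'. cop_moves V E C C' \<and>
         (\<forall>R'. robber_moves V E (capture C' R) R' \<longrightarrow> cops_win_within V E t C' (capture C' R'))))"

definition valid_robber_start :: "'a set \<Rightarrow> nat \<Rightarrow> 'a option list \<Rightarrow> bool" where
  "valid_robber_start V m R \<longleftrightarrow> length R = m \<and> (\<forall>i<m. \<exists>x\<in>V. R ! i = Some x)"

text \<open>k cops can guarantee capture of all m robbers by (the end of) round t.\<close>
definition cops_can_win_by :: "'a set \<Rightarrow> ('a \<Rightarrow> 'a \<Rightarrow> bool) \<Rightarrow> nat \<Rightarrow> nat \<Rightarrow> nat \<Rightarrow> bool" where
  "cops_can_win_by V E k m t \<longleftrightarrow>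
     (\<exists>C0. length C0 = k \<and> set C0 \<subseteq> V \<and>
        (\<forall>R0. valid_robber_start V m R0 \<longrightarrow> cops_win_within V E t C0 (capture C0 R0)))"

definition k_cop_win :: "'a set \<Rightarrow> ('a \<Rightarrow> 'a \<Rightarrow> bool) \<Rightarrow> nat \<Rightarrow> bool" where
  "k_cop_win V E k \<longleftrightarrow> (\<exists>t. cops_can_win_by V E k 1 t)"

abbreviation cop_win :: "'a set \<Rightarrow> ('a \<Rightarrow> 'a \<Rightarrow> bool) \<Rightarrow> bool" where
  "cop_win V E \<equiv> k_cop_win V E 1"

definition capt_l :: "'a set \<Rightarrow> ('a \<Rightarrow> 'a \<Rightarrow> bool) \<Rightarrow> nat \<Rightarrow> nat \<Rightarrow> nat" where
  "capt_l V E l m = (LEAST t. cops_can_win_by V E l m t)"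

abbreviation capt :: "'a set \<Rightarrow> ('a \<Rightarrow> 'a \<Rightarrow> bool) \<Rightarrow> nat \<Rightarrow> nat" where
  "capt V E m \<equiv> capt_l V E 1 m"

text \<open>Z: start vertices from which one cop captures one robber by round t.\<close>
definition good_starts :: "'a set \<Rightarrow> ('a \<Rightarrow> 'a \<Rightarrow> bool) \<Rightarrow> nat \<Rightarrow> 'a set" where
  "good_starts V E t = {v\<in>V. \<forall>w\<in>V. cops_win_within V E t [v] (capture [v] [Some w])}"

definition d_Z :: "'a set \<Rightarrow> ('a \<Rightarrow> 'a \<Rightarrow> bool) \<Rightarrow> 'a set \<Rightarrow> nat" where
  "d_Z V E Z = Max {set_dist V E x Z | x u. trap V E u \<and> x \<in> cnbhd V E u}"

end

theory Submission
  imports Defs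
begin

text \<open>A single cop starts in \<open>Z\<close>, chases one active robber and ignores the others, walks back to
  \<open>Z\<close> after the capture, and repeats.  If the cop at \<open>v\<close> has just moved, the robber at \<open>w\<close> is to
  move, and the cop can still capture within \<open>t\<close> rounds, then some trap lies within distance
  \<open>t - 1\<close> of \<open>w\<close>.  A robber who plays badly and is captured \<open>s\<close> rounds too early is therefore
  captured at distance at most \<open>d\<^sub>Z + s\<close> from \<open>Z\<close>, so each chase together with the walk back takes at
  most \<open>n - 4 + d\<^sub>Z\<close> rounds.

  That \<open>Z\<close> is nonempty follows by deleting traps, which shortens the capture time by at most
  one, once the case of seven vertices is settled.  Two traps can be deleted at once, for the same
  price, as soon as the graph has at least two traps.  Cop-win graphs on at most six vertices have
  two traps, so those on five vertices have capture time at most \<open>2\<close> and those on seven vertices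
  with two traps at most \<open>3\<close>.  If there is a unique trap on seven vertices, then deleting it and
  then two further traps leaves four vertices, and one of these dominates the other three.\<close>

section \<open>One cop against one robber\<close>

text \<open>The game with one cop at \<open>v\<close> and one robber at \<open>w\<close>, cop to
  move, without option lists. As \<open>adj W E\<close> restricts \<open>E\<close> to
  \<open>W\<close>, deleting vertices changes \<open>W\<close> alone.\<close>

fun catches :: "'a set \<Rightarrow> ('a \<Rightarrow> 'a \<Rightarrow> bool) \<Rightarrow> nat \<Rightarrow> 'a \<Rightarrow> 'a \<Rightarrow> bool" where
  "catches W E 0 v w = (v = w)"
| "catches W E (Suc t) v w = (v = w \<or> (\<exists>v'. adj W E v v' \<and>
     (v' = w \<or> (\<forall>w'. adj W E w w' \<longrightarrow> catches W E t v' w'))))"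

definition capture_within :: "'a set \<Rightarrow> ('a \<Rightarrow> 'a \<Rightarrow> bool) \<Rightarrow> nat \<Rightarrow> bool" where
  "capture_within W E t \<longleftrightarrow> (\<exists>v\<in>W. \<forall>w\<in>W. catches W E t v w)"

definition dominated :: "'a set \<Rightarrow> ('a \<Rightarrow> 'a \<Rightarrow> bool) \<Rightarrow> 'a \<Rightarrow> 'a \<Rightarrow> bool" where
  "dominated W E u v \<longleftrightarrow> u \<in> W \<and> v \<in> W \<and> v \<noteq> u \<and> (\<forall>x. adj W E u x \<longrightarrow> adj W E v x)"

lemma trap_iff: "trap W E u \<longleftrightarrow> (\<exists>v. dominated W E u v)"
  by (auto simp: trap_def dominated_def cnbhd_def)

lemma dominated_trap: "dominated W E u v \<Longrightarrow> trap W E u"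
  by (auto simp: trap_iff)

lemma adj_refl: "x \<in> W \<Longrightarrow> adj W E x x"
  by (simp add: adj_def)

lemma adj_sym: "symp E \<Longrightarrow> adj W E x y \<Longrightarrow> adj W E y x"
  by (auto simp: adj_def dest: sympD)

lemma adj_mem: "adj W E x y \<Longrightarrow> x \<in> W \<and> y \<in> W"
  by (simp add: adj_def)

lemma catches_Suc_cases:
  assumes "catches W E (Suc t) v w"
  obtains "v = w"
  | v' where "adj W E v v'" "v' = w"
  | v' where "adj W E v v'" "v' \<noteq> w" "\<And>w'. adj W E w w' \<Longrightarrow> catches W E t v' w'"
  using assms by auto

lemma catches_SucI:
  assumes "adj W E v v'" "v' \<noteq> w \<Longrightarrow> (\<And>w'. adj W E w w' \<Longrightarrow> catches W E t v' w')"
  shows "catches W E (Suc t) v w"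
  using assms by auto

declare catches.simps(2) [simp del]

lemma catches_refl: "catches W E t v v"
  by (cases t) (auto simp: catches.simps(2))

lemma catches_adj: "adj W E v w \<Longrightarrow> catches W E (Suc t) v w"
  by (rule catches_SucI) auto

text \<open>While the cop's answer \<open>v'\<close> does not dominate \<open>w\<close>, the robber
  can step outside the neighbourhood of \<open>v'\<close> and is again not adjacent to the cop, with
  one round fewer left. This cannot go on, so some vertex on the way is dominated.\<close>

lemma trap_if_caught:
  assumes "catches W E t v w" "w \<in> W" "\<not> adj W E v w" "v \<in> W"
  shows "\<exists>u. trap W E u"
  using assms
proof (induction t arbitrary: v w)
  case 0
  then show ?case by (auto simp: adj_def)
next
  case (Suc t)
  then obtain v' where v': "adj W E v v'" "v' \<noteq> w"
    "\<And>w'. adj W E w w' \<Longrightarrow> catches W E t v' w'"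
    by (auto simp: adj_def elim: catches_Suc_cases)
  show ?case
  proof (cases "\<forall>x. adj W E w x \<longrightarrow> adj W E v' x")
    case True
    then have "dominated W E w v'"
      using v' Suc.prems adj_mem[OF v'(1)] by (auto simp: dominated_def)
    then show ?thesis by (auto simp: trap_iff)
  next
    case False
    then show ?thesis
      using Suc.IH v' adj_mem by metis
  qed
qed

lemma dominated_by_universal:
  assumes "\<And>x. x \<in> W \<Longrightarrow> adj W E v x" "u \<in> W" "v \<in> W" "u \<noteq> v"
  shows "dominated W E u v"
  using assms by (auto simp: dominated_def dest: adj_mem)

text \<open>If the cop's start is adjacent to everything, it dominates any other vertex; otherwise
  the robber starts at a vertex not adjacent to it.\<close>

lemma capture_within_trap:
  assumes "capture_within W E t" "x \<in> W" "y \<in> W" "x \<noteq> y"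
  shows "\<exists>u. trap W E u"
proof -
  obtain v where v: "v \<in> W" "\<And>w. w \<in> W \<Longrightarrow> catches W E t v w"
    using assms(1) by (auto simp: capture_within_def)
  show ?thesis
  proof (cases "\<forall>w\<in>W. adj W E v w")
    case True
    then show ?thesis
      using dominated_by_universal[of W E v] v(1) assms unfolding trap_iff by metis
  next
    case False
    then show ?thesis
      using trap_if_caught v by metis
  qed
qed

lemma catches_not_isolated:
  assumes "catches W E t v w" "v \<noteq> w" "symp E" "v \<in> W" "w \<in> W"
  shows "\<exists>x. x \<noteq> w \<and> adj W E w x"
  using assms
proof (induction t arbitrary: v)
  case (Suc t)
  then obtain v' where v': "adj W E v v'"
    "v' = w \<or> catches W E t v' w"
    by (auto simp: adj_refl elim: catches_Suc_cases)
  then show ?case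
    using Suc adj_sym adj_mem by metis
qed simp

lemma capture_within_not_isolated:
  assumes "capture_within W E t" "symp E" "x \<in> W" "y \<in> W" "x \<noteq> y"
  shows "\<exists>z. z \<noteq> x \<and> adj W E x z"
proof -
  obtain v where v: "v \<in> W" "\<And>w. w \<in> W \<Longrightarrow> catches W E t v w"
    using assms(1) by (auto simp: capture_within_def)
  show ?thesis
  proof (cases "v = x")
    case False
    then show ?thesis using catches_not_isolated v assms by metis
  next
    case True
    then have "\<not> (\<forall>z. adj W E x z \<longrightarrow> z = x)"
    proof (intro notI)
      assume a: "\<forall>z. adj W E x z \<longrightarrow> z = x"
      \<comment> \<open>A cop starting at an isolated \<open>x\<close> can never leave it, so a
        robber who stays at \<open>y\<close> is safe.\<close>
      have "\<not> catches W E s x y" for s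
      proof (induction s)
        case (Suc s)
        then show ?case using a assms adj_refl[of y W E] by (metis catches.simps(2))
      qed (simp add: assms)
      then show False using v True assms by blast
    qed
    then show ?thesis by blast
  qed
qed

section \<open>Retractions that delete dominated vertices\<close>

definition retraction :: "'a set \<Rightarrow> ('a \<Rightarrow> 'a \<Rightarrow> bool) \<Rightarrow> 'a set \<Rightarrow> ('a \<Rightarrow> 'a) \<Rightarrow> bool" where
  "retraction W E U r \<longleftrightarrow> U \<subseteq> W \<and> r ` W \<subseteq> U \<and> (\<forall>x\<in>U. r x = x) \<and>
     (\<forall>x y. adj W E x y \<longrightarrow> adj W E (r x) y)"

text \<open>The last clause of \<open>retraction\<close> makes \<open>r x\<close> dominate
  \<open>x\<close>. Applied at both ends of an edge, with symmetry in between, it makes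
  \<open>r\<close> a homomorphism.\<close>

lemma retraction_adj:
  assumes "retraction W E U r" "symp E" "adj W E x y"
  shows "adj U E (r x) (r y)"
proof -
  have "adj W E (r x) (r y)"
    using assms adj_sym unfolding retraction_def by metis
  then show ?thesis
    using assms(1) adj_mem[OF assms(3)] by (auto simp: adj_def retraction_def)
qed

lemma adj_mono: "adj U E x y \<Longrightarrow> U \<subseteq> W \<Longrightarrow> adj W E x y"
  by (auto simp: adj_def)

text \<open>The cop plays the image under \<open>r\<close> of the strategy on \<open>W\<close>. A
  robber confined to \<open>U\<close> is fixed by \<open>r\<close>, so his capture carries
  over.\<close>

lemma catches_retract:
  assumes "retraction W E U r" "symp E"
  shows "catches W E t v w \<Longrightarrow> w \<in> U \<Longrightarrow> catches U E t (r v) w"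
proof (induction t arbitrary: v w)
  case 0
  then show ?case using assms by (auto simp: retraction_def)
next
  case (Suc t)
  have rw: "r w = w" and UW: "U \<subseteq> W" using assms Suc.prems by (auto simp: retraction_def)
  show ?case
  proof (cases "v = w")
    case True
    then show ?thesis by (simp add: rw catches_refl)
  next
    case False
    then obtain v' where v': "adj W E v v'"
      "v' = w \<or> (\<forall>w'. adj W E w w' \<longrightarrow> catches W E t v' w')"
      using Suc.prems by (auto elim: catches_Suc_cases)
    have "adj U E (r v) (r v')"
      using retraction_adj[OF assms v'(1)] .
    moreover have "r v' = w \<or> (\<forall>w'. adj U E w w' \<longrightarrow> catches U E t (r v') w')"
      using v'(2) rw Suc.IH adj_mono[OF _ UW] adj_mem[of U E] by metis
    ultimately show ?thesis by (subst catches.simps(2)) blast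
  qed
qed

text \<open>The cop stays in \<open>U\<close> and chases the shadow \<open>r w\<close>. Once on the
  shadow, the cop is adjacent to every vertex that the robber can step to, so a single extra round
  suffices however many vertices \<open>r\<close> moves.\<close>

lemma catches_lift:
  assumes "retraction W E U r" "symp E"
  shows "catches U E t v (r w) \<Longrightarrow> v \<in> U \<Longrightarrow> w \<in> W \<Longrightarrow> catches W E (Suc t) v w"
proof (induction t arbitrary: v w)
  case 0
  then have "adj W E v w"
    using assms adj_refl[of w W E] by (auto simp: retraction_def)
  then show ?case by (rule catches_adj)
next
  case (Suc t)
  have cov: "adj W E (r w) y" if "adj W E w y" for y
    using assms that by (auto simp: retraction_def)
  have UW: "U \<subseteq> W" using assms by (auto simp: retraction_def)
  show ?case
  proof (cases "v = r w")
    case True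
    then show ?thesis using cov[OF adj_refl[OF Suc.prems(3)]] catches_adj by metis
  next
    case False
    then obtain v' where v': "adj U E v v'"
      "v' = r w \<or> (\<forall>w'. adj U E (r w) w' \<longrightarrow> catches U E t v' w')"
      using Suc.prems by (auto elim: catches_Suc_cases)
    have "catches W E (Suc t) v' w'" if w': "adj W E w w'" for w'
      using v'(2)
    proof
      assume "v' = r w"
      then show ?thesis using catches_adj[OF cov[OF w']] by simp
    next
      assume "\<forall>w'. adj U E (r w) w' \<longrightarrow> catches U E t v' w'"
      then have "catches U E t v' (r w')" using retraction_adj[OF assms w'] by blast
      then show ?thesis using Suc.IH adj_mem[OF v'(1)] adj_mem[OF w'] by blast
    qed
    then show ?thesis
      using adj_mono[OF v'(1) UW] by (subst catches.simps(2)) blast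
  qed
qed

lemma capture_within_retract:
  assumes "retraction W E U r" "symp E" "capture_within W E t"
  shows "capture_within U E t"
proof -
  obtain v where v: "v \<in> W" "\<And>w. w \<in> W \<Longrightarrow> catches W E t v w"
    using assms(3) by (auto simp: capture_within_def)
  then have "catches U E t (r v) w" if "w \<in> U" for w
    using catches_retract[OF assms(1,2)] that assms(1) by (auto simp: retraction_def)
  then show ?thesis
    using v(1) assms(1) unfolding capture_within_def retraction_def by blast
qed

lemma capture_within_lift:
  assumes "retraction W E U r" "symp E" "capture_within U E t"
  shows "capture_within W E (Suc t)"
proof -
  obtain v where v: "v \<in> U" "\<And>w. w \<in> U \<Longrightarrow> catches U E t v w"
    using assms(3) by (auto simp: capture_within_def)
  then have "catches W E (Suc t) v w" if "w \<in> W" for w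
    using catches_lift[OF assms(1,2)] that assms(1) unfolding retraction_def by blast
  then show ?thesis
    using v(1) assms(1) unfolding capture_within_def retraction_def by blast
qed

lemma retraction_dominated:
  assumes "dominated W E u p"
  shows "retraction W E (W - {u}) (\<lambda>x. if x = u then p else x)"
  using assms by (auto simp: retraction_def dominated_def)

text \<open>The two inequalities say that each dominating vertex survives the deletion of the other
  trap.\<close>

lemma retraction_dominated_pair:
  assumes "dominated W E u p" "dominated W E v q" "q \<noteq> u" "p \<noteq> v"
  shows "retraction W E (W - {u, v}) (\<lambda>x. if x = u then p else if x = v then q else x)"
  using assms by (auto simp: retraction_def dominated_def)

lemma dominated_trans:
  "dominated W E u v \<Longrightarrow> dominated W E v w \<Longrightarrow> w \<noteq> u \<Longrightarrow> dominated W E u w"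
  by (auto simp: dominated_def)

text \<open>If no two traps can be deleted together, the two given ones are twins that dominate only
  each other. Deleting one twin leaves at least two vertices and hence a trap, which is also a trap
  of \<open>W\<close> and can be deleted together with the first twin after all.\<close>

lemma two_traps_retraction:
  assumes cw: "capture_within W E t" and sym: "symp E" and W: "card W \<ge> 3"
    and tr: "trap W E u1" "trap W E u2" "u1 \<noteq> u2"
  shows "\<exists>u v r. u \<in> W \<and> v \<in> W \<and> u \<noteq> v \<and> retraction W E (W - {u, v}) r"
proof (rule ccontr)
  assume neg: "\<not> ?thesis"
  have no: "q = u \<or> p = v" if "dominated W E u p" "dominated W E v q" "u \<noteq> v" for u v p q
  proof (rule ccontr)
    assume "\<not> ?thesis"
    then have "retraction W E (W - {u, v}) (\<lambda>x. if x = u then p else if x = v then q else x)"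
      using retraction_dominated_pair[OF that(1,2)] by blast
    moreover have "u \<in> W" "v \<in> W" using that by (auto simp: dominated_def)
    ultimately show False using neg that(3) by blast
  qed
  obtain p1 p2 where p: "dominated W E u1 p1" "dominated W E u2 p2"
    using tr by (auto simp: trap_iff)
  \<comment> \<open>Otherwise transitivity makes \<open>q\<close> dominate both \<open>a\<close> and
    \<open>b\<close>, and \<open>q\<close> survives the deletion of both.\<close>
  have mutual: "q = a" if ab: "dominated W E a b" and q: "dominated W E b q" for a b q
  proof (rule ccontr)
    assume "q \<noteq> a"
    then have "dominated W E a q" using dominated_trans[OF ab q] by simp
    moreover have "a \<noteq> b" "q \<noteq> b" using ab q by (auto simp: dominated_def)
    ultimately show False using no[OF _ q] \<open>q \<noteq> a\<close> by blast
  qed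
  have d: "dominated W E u1 u2" "dominated W E u2 u1"
    using no[OF p tr(3)] mutual[of u1 u2 p2] mutual[of u2 u1 p1] p by auto
  then have only: "q = u1" if "dominated W E u2 q" for q
    using mutual that by blast
  have "\<not> W \<subseteq> {u1, u2}"
    using W card_mono[of "{u1, u2}" W] tr(3) by auto
  then obtain x where x: "x \<in> W" "x \<noteq> u1" "x \<noteq> u2" by blast
  let ?U = "W - {u1}"
  have "capture_within ?U E t"
    using capture_within_retract[OF retraction_dominated[OF d(1)] sym cw] .
  then obtain w where "trap ?U E w"
    using capture_within_trap[of ?U E t x u2] x d by (auto simp: dominated_def)
  then obtain q where q: "dominated ?U E w q" by (auto simp: trap_iff)
  have tw: "adj W E u1 y \<longleftrightarrow> adj W E u2 y" for y
    using d by (auto simp: dominated_def)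
  \<comment> \<open>Domination by \<open>q\<close> survives the return of \<open>u1\<close>, whose
    adjacencies are those of its twin \<open>u2\<close>.\<close>
  have "adj W E q y" if y: "adj W E w y" for y
  proof (cases "y = u1")
    case True
    have "adj W E w u2" using tw y True adj_sym[OF sym] by metis
    then have "adj ?U E w u2" using q d(1) by (auto simp: dominated_def adj_def)
    then have "adj W E q u2" using q adj_mono[of ?U E q u2 W] by (auto simp: dominated_def)
    then show ?thesis using tw True adj_sym[OF sym] by metis
  next
    case False
    then show ?thesis using y q by (auto simp: dominated_def adj_def)
  qed
  then have qW: "dominated W E w q" using q by (auto simp: dominated_def)
  have "q \<noteq> u1" "w \<noteq> u1" using q by (auto simp: dominated_def)
  moreover from this have "w \<noteq> u2" using only qW by blast
  ultimately show False using no[OF qW d(1)] \<open>q \<noteq> u1\<close> by auto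
qed

section \<open>Small graphs with a unique trap\<close>

text \<open>Names the vertex left over by a list of known ones. It may lie in \<open>A\<close>, so
  graphs smaller than the bound need no separate case; \<open>a\<close> is the value when
  \<open>W = A\<close>.\<close>

lemma all_but_one:
  assumes "finite W" "A \<subseteq> W" "card W \<le> Suc (card A)" "a \<in> A"
  shows "\<exists>r\<in>W. \<forall>z\<in>W. z = r \<or> z \<in> A"
proof (cases "W = A")
  case True
  then show ?thesis using assms by blast
next
  case False
  then obtain r where r: "r \<in> W" "r \<notin> A" using assms by blast
  then have "W = insert r A"
    using assms finite_subset[OF assms(2,1)] by (intro card_seteq[symmetric]) auto
  then show ?thesis using r by blast
qed

lemma all_but_two:
  assumes "finite W" "A \<subseteq> W" "card W \<le> Suc (Suc (card A))" "a \<in> A"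
  shows "\<exists>r\<in>W. \<exists>s\<in>W. \<forall>z\<in>W. z = r \<or> z = s \<or> z \<in> A"
proof (cases "W = A")
  case True
  then show ?thesis using assms by blast
next
  case False
  then obtain r where r: "r \<in> W" "r \<notin> A" using assms by blast
  then show ?thesis
    using all_but_one[of W "insert r A" r] assms finite_subset[OF assms(2,1)] by auto
qed

text \<open>The situation of a cop-win graph whose only trap is \<^term>\<open>u\<close>: two traps \<^term>\<open>w1\<close>
  and \<^term>\<open>w2\<close> of the graph without \<^term>\<open>u\<close> were no traps before, so they are adjacent to
  \<^term>\<open>u\<close> while their dominating vertices \<^term>\<open>q1\<close>, \<^term>\<open>q2\<close> are not.\<close>

locale unique_trap =
  fixes W :: "'a set" and R :: "'a \<Rightarrow> 'a \<Rightarrow> bool" and u p w1 w2 q1 q2 :: 'a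
  assumes fin: "finite W"
    and refl: "x \<in> W \<Longrightarrow> R x x"
    and sym: "R x y \<Longrightarrow> R y x"
    and mem: "R x y \<Longrightarrow> x \<in> W"
    and nonisolated: "x \<in> W \<Longrightarrow> \<exists>y. y \<noteq> x \<and> R x y"
    and dom: "R u x \<Longrightarrow> R p x"
    and up: "u \<in> W" "p \<in> W" "p \<noteq> u"
    and unique: "x \<in> W \<Longrightarrow> x \<noteq> u \<Longrightarrow> y \<in> W \<Longrightarrow> y \<noteq> x \<Longrightarrow> \<exists>z. R x z \<and> \<not> R y z"
    and w: "R u w1" "R u w2" "w1 \<noteq> w2" "w1 \<noteq> u" "w2 \<noteq> u"
    and q: "q1 \<in> W" "q2 \<in> W" "\<not> R u q1" "\<not> R u q2"
    and dom1: "x \<noteq> u \<Longrightarrow> R w1 x \<Longrightarrow> R q1 x"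
    and dom2: "x \<noteq> u \<Longrightarrow> R w2 x \<Longrightarrow> R q2 x"
begin

lemma mem2: "R x y \<Longrightarrow> y \<in> W"
  using mem sym by blast

text \<open>The only possible neighbour \<open>z\<close> would dominate \<open>x\<close> and make it
  a second trap.\<close>

lemma no_leaf: "x \<in> W \<Longrightarrow> x \<noteq> u \<Longrightarrow> \<not> (\<forall>y. R x y \<longrightarrow> y = x \<or> y = z)"
  using nonisolated unique refl sym mem2 by metis

lemma not_universal: "x \<in> W \<Longrightarrow> \<exists>y\<in>W. \<not> R x y"
  by (metis mem2 q(1) unique w(1-5))

lemma basic: "R p u" "R p w1" "R p w2" "R q1 w1" "R q2 w2" "q1 \<noteq> p" "q2 \<noteq> p" "q1 \<noteq> u" "q2 \<noteq> u"
  "q1 \<noteq> w1" "q1 \<noteq> w2" "q2 \<noteq> w1" "q2 \<noteq> w2" "w1 \<in> W" "w2 \<in> W" "R u p"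
  using dom w q refl mem2 up dom1 dom2 sym by metis+

lemma corner:
  "x \<in> W \<Longrightarrow> x \<noteq> u \<Longrightarrow> y \<in> W \<Longrightarrow> y \<noteq> x \<Longrightarrow> (\<And>z. z \<in> W \<Longrightarrow> R x z \<Longrightarrow> R y z) \<Longrightarrow> False"
  using unique mem2 by blast

lemma p_adj_q:
  assumes "p \<noteq> w1" "p \<noteq> w2"
  shows "R q1 p" "R q2 p"
  using basic dom1 dom2 sym up by metis+

text \<open>If \<open>q1\<close> and \<open>q2\<close> differ, the six named vertices exhaust
  \<open>W\<close> and \<open>p\<close> is adjacent to all of them. If they coincide,
  \<open>p\<close> must miss the remaining vertex \<open>r\<close>, and then \<open>q1\<close>
  dominates \<open>r\<close>.\<close>

lemma six_apart:
  assumes ne: "p \<noteq> w1" "p \<noteq> w2" and card: "card W \<le> 6"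
  shows False
proof (cases "q1 = q2")
  case False
  have "card {u, p, w1, w2, q1, q2} = 6" using ne basic w up False by auto
  moreover have "{u, p, w1, w2, q1, q2} \<subseteq> W" using basic up q by auto
  ultimately have W: "W = {u, p, w1, w2, q1, q2}"
    using card fin card_seteq[of W "{u, p, w1, w2, q1, q2}"] by simp
  have "R p z" if "z \<in> W" for z
    using that p_adj_q[OF ne] basic(1-3) sym refl up(2) unfolding W by blast
  then show False using not_universal up(2) by blast
next
  case True
  have c: "card {u, p, w1, w2, q1} = 5" using ne basic w up by auto
  have sub: "{u, p, w1, w2, q1} \<subseteq> W" using basic up q by auto
  obtain r where r: "r \<in> W" and W: "\<And>z. z \<in> W \<Longrightarrow> z = r \<or> z \<in> {u, p, w1, w2, q1}"
    using all_but_one[OF fin sub, of u] c card by auto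
  have p: "R p q1" "R q1 p" using p_adj_q[OF ne] sym by blast+
  obtain z where "z \<in> W" "\<not> R p z" using not_universal up by blast
  then have pr: "\<not> R p r" using W[of z] basic(1-3) p refl[OF up(2)] by blast
  have ur: "\<not> R u r" using pr dom by blast
  have ru: "r \<noteq> u" using pr basic(1) by blast
  have w1r: "R q1 r" if "R w1 r" using dom1 that ru by blast
  have w2r: "R q1 r" if "R w2 r" using dom2 that ru True by blast
  obtain y where "y \<noteq> r" "R r y" using nonisolated r by blast
  then have qr: "R q1 r" using W[OF mem2[of r y]] pr ur w1r w2r sym by blast
  show False
  proof (rule corner[of r q1])
    show "R q1 z" if "z \<in> W" "R r z" for z
      using W[OF that(1)] that(2) pr ur qr sym basic True refl q by blast
    show "q1 \<noteq> r" using p pr by blast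
  qed (use r q ru in auto)
qed

lemma q2_adj:
  assumes "p = w1"
  shows "R w2 p" "R q1 w2" "R q2 p" "R q1 q2" "R q1 p"
  using assms basic dom1 dom2 sym refl up q w by metis+

text \<open>Otherwise \<open>q1\<close>, which covers all neighbours of \<open>u\<close> except
  \<open>u\<close> itself, dominates every other vertex not adjacent to \<open>u\<close>. So
  \<open>q1\<close> is the only vertex not adjacent to \<open>u\<close>, and then \<open>p\<close>
  dominates \<open>q1\<close>.\<close>

lemma far_vertex:
  assumes "p = w1"
  shows "\<exists>s\<in>W. \<not> R u s \<and> \<not> R q1 s"
proof (rule ccontr)
  assume "\<not> ?thesis"
  then have all: "R u s \<or> R q1 s" if "s \<in> W" for s using that by blast
  have uq: "R q1 z" if "R u z" "z \<noteq> u" for z using dom dom1 that assms by blast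
  have ux: "R u x" if x: "x \<in> W" "x \<noteq> q1" for x
  proof (rule ccontr)
    assume nx: "\<not> R u x"
    show False
    proof (rule corner[of x q1])
      show "R q1 z" if "z \<in> W" "R x z" for z
        using that nx all uq sym by metis
      show "x \<noteq> u" using nx refl up(1) by blast
    qed (use x q in auto)
  qed
  show False
  proof (rule corner[of q1 p])
    show "R p z" if "z \<in> W" "R q1 z" for z
      using ux[of z] that dom q2_adj(5)[OF assms] sym by blast
  qed (use basic q up in auto)
qed

text \<open>A vertex \<open>s\<close> missed by \<open>u\<close> and \<open>q1\<close> is missed by
  \<open>p\<close> too, as \<open>q1\<close> covers the neighbours of \<open>p = w1\<close> other
  than \<open>u\<close>. If \<open>w2\<close> sees \<open>s\<close>, then \<open>q2\<close> is the
  remaining vertex and dominates \<open>s\<close>; otherwise \<open>s\<close> is a leaf at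
  \<open>r\<close>.\<close>

lemma six_adjacent:
  assumes pw: "p = w1" and card: "card W \<le> 6"
  shows False
proof -
  obtain s where s: "s \<in> W" "\<not> R u s" "\<not> R q1 s" using far_vertex[OF pw] by blast
  note a = q2_adj[OF pw]
  have su: "s \<noteq> u" using s(2) refl up(1) by blast
  have ps: "\<not> R p s" using s(3) su dom1 pw by blast
  have ne: "s \<noteq> p" "s \<noteq> w2" "s \<noteq> q1" using s refl q up basic w by metis+
  have c: "card {u, p, w2, q1, s} = 5" using ne su basic w up pw by auto
  have sub: "{u, p, w2, q1, s} \<subseteq> W" using basic up q s by auto
  obtain r where r: "r \<in> W" and W: "\<And>z. z \<in> W \<Longrightarrow> z = r \<or> z \<in> {u, p, w2, q1, s}"
    using all_but_one[OF fin sub, of u] c card by auto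
  show False
  proof (cases "R w2 s")
    case True
    then have qs: "R q2 s" using dom2 su by blast
    then have "q2 \<noteq> q1" "q2 \<noteq> s" using s a ps sym by blast+
    then have "q2 = r" using W[OF q(2)] basic by blast
    show False
    proof (rule corner[of s q2])
      show "R q2 z" if "z \<in> W" "R s z" for z
        using W[OF that(1)] that(2) ps s qs sym basic refl[OF q(2)] \<open>q2 = r\<close> by blast
    qed (use s q su \<open>q2 \<noteq> s\<close> in auto)
  next
    case False
    have "y = s \<or> y = r" if "R s y" for y
      using W[OF mem2[OF that]] that False ps s sym by blast
    then show False using no_leaf[OF s(1) su, of r] by blast
  qed
qed

end

text \<open>Both conditions concern what is left after deleting \<open>u\<close>, \<open>w1\<close>,
  \<open>w2\<close>. A vertex adjacent to all of the rest would give capture within three rounds,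
  and an induced 4-cycle has no trap.\<close>

locale unique_trap_four = unique_trap +
  assumes not_star: "x \<in> W \<Longrightarrow> x \<notin> {u, w1, w2} \<Longrightarrow> \<exists>y\<in>W. y \<notin> {u, w1, w2} \<and> \<not> R x y"
    and not_cycle: "(\<And>z. z \<in> W \<Longrightarrow> z \<in> {u, w1, w2, a, b, c, d}) \<Longrightarrow>
      {a, b, c, d} \<inter> {u, w1, w2} = {} \<Longrightarrow>
      R a b \<Longrightarrow> R b c \<Longrightarrow> R c d \<Longrightarrow> R d a \<Longrightarrow> \<not> R a c \<Longrightarrow> \<not> R b d \<Longrightarrow> False"
begin

text \<open>The remaining vertex \<open>r\<close> is missed by \<open>p\<close> and seen by
  \<open>q1\<close> or \<open>q2\<close>. If only one of them sees it, that one dominates it. If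
  both do, either \<open>q1\<close> is adjacent to all of \<open>p\<close>, \<open>q2\<close>,
  \<open>r\<close>, or \<open>p\<close>, \<open>q1\<close>, \<open>r\<close>, \<open>q2\<close> is
  an induced cycle.\<close>

lemma seven_apart_neq:
  assumes ne: "p \<noteq> w1" "p \<noteq> w2" and card: "card W \<le> 7" and qq: "q1 \<noteq> q2"
  shows False
proof -
  have c: "card {u, p, w1, w2, q1, q2} = 6" using ne basic w up qq by auto
  have sub: "{u, p, w1, w2, q1, q2} \<subseteq> W" using basic up q by auto
  obtain r where r: "r \<in> W" and W: "\<And>z. z \<in> W \<Longrightarrow> z = r \<or> z \<in> {u, p, w1, w2, q1, q2}"
    using all_but_one[OF fin sub, of u] c card by auto
  have p: "R p q1" "R q1 p" "R p q2" "R q2 p" using p_adj_q[OF ne] sym by blast+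
  obtain z where "z \<in> W" "\<not> R p z" using not_universal up by blast
  then have pr: "\<not> R p r" using W[of z] basic(1-3) p refl[OF up(2)] by blast
  have ur: "\<not> R u r" using pr dom by blast
  have ru: "r \<noteq> u" "r \<noteq> w1" "r \<noteq> w2" "r \<noteq> q1" "r \<noteq> q2" using pr basic p by blast+
  have w1r: "R q1 r" if "R w1 r" using dom1 that ru by blast
  have w2r: "R q2 r" if "R w2 r" using dom2 that ru by blast
  obtain y where "y \<noteq> r" "R r y" using nonisolated r by blast
  then have qr: "R q1 r \<or> R q2 r" using W[OF mem2[of r y]] pr ur w1r w2r sym by blast
  show False
  proof (cases "R q1 r \<and> R q2 r")
    case True
    show False
    proof (cases "R q1 q2")
      case t: True
      obtain y where "y \<in> W" "y \<notin> {u, w1, w2}" "\<not> R q1 y"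
        using not_star[of q1] q basic by blast
      then show False using W[of y] True t refl[OF q(1)] p by blast
    next
      case False
      have "{p, q1, r, q2} \<inter> {u, w1, w2} = {}" using ne up basic ru by auto
      moreover have "z \<in> {u, w1, w2, p, q1, r, q2}" if "z \<in> W" for z
        using W[OF that] by blast
      ultimately show False using not_cycle[of p q1 r q2] True False p pr sym by blast
    qed
  next
    case False
    then consider "R q1 r" "\<not> R w2 r" "\<not> R q2 r" | "R q2 r" "\<not> R w1 r" "\<not> R q1 r"
      using qr w1r w2r by blast
    then show False
    proof cases
      case 1
      show False
      proof (rule corner[of r q1])
        show "R q1 z" if "z \<in> W" "R r z" for z
          using W[OF that(1)] that(2) 1 pr ur sym basic refl[OF q(1)] by blast
      qed (use r q ru in auto)
    next
      case 2
      show False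
      proof (rule corner[of r q2])
        show "R q2 z" if "z \<in> W" "R r z" for z
          using W[OF that(1)] that(2) 2 pr ur sym basic refl[OF q(2)] by blast
      qed (use r q ru in auto)
    qed
  qed
qed

text \<open>Being missed by \<open>q1\<close>, the vertex \<open>s\<close> is missed by
  \<open>w1\<close> and \<open>w2\<close>. Either \<open>s\<close> is a leaf at \<open>r\<close>, or
  \<open>p\<close> sees \<open>s\<close> and therefore, by \<open>not_star\<close>, misses
  \<open>r\<close>. Then \<open>r\<close> is a leaf at \<open>s\<close>, is dominated by
  \<open>q1\<close>, or closes the cycle \<open>p\<close>, \<open>q1\<close>, \<open>r\<close>,
  \<open>s\<close>.\<close>

lemma seven_apart_eq_aux:
  assumes ne: "p \<noteq> w1" "p \<noteq> w2" and qq: "q1 = q2"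
    and rs: "r \<in> W" "s \<in> W" and W: "\<And>z. z \<in> W \<Longrightarrow> z = r \<or> z = s \<or> z \<in> {u, p, w1, w2, q1}"
    and s: "\<not> R q1 s" "s \<notin> {u, w1, w2}"
  shows False
proof -
  have p: "R p q1" "R q1 p" using p_adj_q[OF ne] sym by blast+
  have sw: "\<not> R w1 s" "\<not> R w2 s" using dom1 dom2 s qq by blast+
  show False
  proof (cases "R p s")
    case False
    have "y = s \<or> y = r" if "R s y" for y
      using W[OF mem2[OF that]] that False sw s dom sym by blast
    then show False using no_leaf[OF rs(2), of r] s by blast
  next
    case True
    obtain y where y: "y \<in> W" "y \<notin> {u, w1, w2}" "\<not> R p y"
      using not_star[of p] up ne by blast
    then have "y = r" using W[of y] True p refl[OF up(2)] by blast
    then have pr: "\<not> R p r" and r: "r \<notin> {u, w1, w2}" using y by blast+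
    have ur: "\<not> R u r" using pr dom by blast
    show False
    proof (cases "R q1 r")
      case qr: True
      show False
      proof (cases "R r s")
        case rs': True
        have "{p, q1, r, s} \<inter> {u, w1, w2} = {}" using ne up basic r s by auto
        moreover have "z \<in> {u, w1, w2, p, q1, r, s}" if "z \<in> W" for z
          using W[OF that] by blast
        ultimately show False using not_cycle[of p q1 r s] True qr rs' p pr s sym by blast
      next
        case False
        show False
        proof (rule corner[of r q1])
          show "R q1 z" if "z \<in> W" "R r z" for z
            using W[OF that(1)] that(2) False qr qq pr ur sym basic refl[OF q(1)] by blast
          show "q1 \<noteq> r" using p pr by blast
        qed (use rs q r in auto)
      qed
    next
      case False
      have rw: "\<not> R w1 r" "\<not> R w2 r" using dom1 dom2 False r qq by blast+
      have "y = r \<or> y = s" if "R r y" for y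
        using W[OF mem2[OF that]] that False rw pr ur sym by blast
      then show False using no_leaf[OF rs(1), of s] r by blast
    qed
  qed
qed

lemma seven_apart_eq:
  assumes ne: "p \<noteq> w1" "p \<noteq> w2" and card: "card W \<le> 7" and qq: "q1 = q2"
  shows False
proof -
  have c: "card {u, p, w1, w2, q1} = 5" using ne basic w up by auto
  have sub: "{u, p, w1, w2, q1} \<subseteq> W" using basic up q by auto
  obtain r s where rs: "r \<in> W" "s \<in> W"
    and W: "\<And>z. z \<in> W \<Longrightarrow> z = r \<or> z = s \<or> z \<in> {u, p, w1, w2, q1}"
    using all_but_two[OF fin sub, of u] c card by auto
  have p: "R q1 p" using p_adj_q[OF ne] by blast
  obtain y where y: "y \<in> W" "y \<notin> {u, w1, w2}" "\<not> R q1 y"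
    using not_star[of q1] q basic by blast
  then have "y = r \<or> y = s" using W[of y] p refl[OF q(1)] by blast
  \<comment> \<open>Whichever of the two extra vertices is missed by \<open>q1\<close> takes the
    part of \<open>s\<close>.\<close>
  then show False
    using seven_apart_eq_aux[OF ne qq rs W] seven_apart_eq_aux[OF ne qq rs(2,1)] W y by blast
qed

text \<open>If \<open>q2\<close> misses the far vertex \<open>s\<close>, then \<open>s\<close> is a
  leaf at \<open>t\<close>. Otherwise \<open>q2\<close> misses \<open>t\<close> by
  \<open>not_star\<close>, and \<open>s\<close> sees \<open>t\<close>, since \<open>q2\<close> would
  dominate \<open>s\<close> if not. Now \<open>t\<close> is a leaf at \<open>s\<close> or closes the
  cycle \<open>q1\<close>, \<open>q2\<close>, \<open>s\<close>, \<open>t\<close>.\<close>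

lemma seven_adjacent_neq:
  assumes pw: "p = w1" and card: "card W \<le> 7" and qq: "q1 \<noteq> q2"
  shows False
proof -
  obtain s where s: "s \<in> W" "\<not> R u s" "\<not> R q1 s" using far_vertex[OF pw] by blast
  note a = q2_adj[OF pw]
  have su: "s \<noteq> u" using s(2) refl up(1) by blast
  have ps: "\<not> R p s" using s(3) su dom1 pw by blast
  have ne: "s \<noteq> p" "s \<noteq> w2" "s \<noteq> q1" "s \<noteq> q2" using s refl q up basic w a by metis+
  have c: "card {u, p, w2, q1, q2, s} = 6" using ne su basic w up pw qq by auto
  have sub: "{u, p, w2, q1, q2, s} \<subseteq> W" using basic up q s by auto
  obtain t where t: "t \<in> W" and W: "\<And>z. z \<in> W \<Longrightarrow> z = t \<or> z \<in> {u, p, w2, q1, q2, s}"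
    using all_but_one[OF fin sub, of u] c card by auto
  show False
  proof (cases "R q2 s")
    case True
    obtain y where y: "y \<in> W" "y \<notin> {u, w1, w2}" "\<not> R q2 y"
      using not_star[of q2] q basic by blast
    then have "y = t" using W[of y] True a sym pw refl[OF q(2)] by blast
    then have qt: "\<not> R q2 t" and tu: "t \<notin> {u, w1, w2}" using y by blast+
    have st: "R s t"
    proof (rule ccontr)
      assume st: "\<not> R s t"
      show False
      proof (rule corner[of s q2])
        show "R q2 z" if "z \<in> W" "R s z" for z
          using W[OF that(1)] that(2) st ps s True sym basic refl[OF q(2)] by blast
      qed (use s q su ne in auto)
    qed
    show False
    proof (cases "R q1 t")
      case qt': True
      have "{q1, q2, s, t} \<inter> {u, w1, w2} = {}" using basic su ne pw tu by auto
      moreover have "z \<in> {u, w1, w2, q1, q2, s, t}" if "z \<in> W" for z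
        using W[OF that] pw by blast
      ultimately show False using not_cycle[of q1 q2 s t] True qt qt' st a s sym by blast
    next
      case False
      have "\<not> R p t" "\<not> R u t" "\<not> R w2 t" using dom dom1 dom2 pw tu False qt by blast+
      then have "y = t \<or> y = s" if "R t y" for y
        using W[OF mem2[OF that]] that False qt sym by blast
      then show False using no_leaf[OF t, of s] tu by blast
    qed
  next
    case False
    then have "\<not> R w2 s" using dom2 su by blast
    then have "y = s \<or> y = t" if "R s y" for y
      using W[OF mem2[OF that]] that False ps s sym by blast
    then show False using no_leaf[OF s(1) su, of t] by blast
  qed
qed

lemma seven_adjacent_eq_aux:
  assumes pw: "p = w1" and qq: "q1 = q2"
    and W: "\<And>z. z \<in> W \<Longrightarrow> z = r \<or> z = t \<or> z \<in> {u, p, w2, q1, s}"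
    and t: "t \<in> W" "t \<noteq> u" "\<not> R q1 t" "\<not> R r t"
  shows False
proof -
  have "\<not> R p t" "\<not> R u t" "\<not> R w2 t" using dom dom1 dom2 pw qq t by blast+
  then have "y = t \<or> y = s" if "R t y" for y
    using W[OF mem2[OF that]] that t sym by blast
  then show False using no_leaf[OF t(1,2), of s] by blast
qed

text \<open>The far vertex \<open>s\<close> can see only \<open>r\<close> and \<open>t\<close>, and
  it sees both because it is no leaf. If \<open>q1\<close> sees neither of them, \<open>p\<close>
  dominates \<open>q1\<close>; if it sees one, the other is a leaf at \<open>s\<close>; if it sees
  both, there is an induced cycle.\<close>

lemma seven_adjacent_eq:
  assumes pw: "p = w1" and card: "card W \<le> 7" and qq: "q1 = q2"
  shows False
proof -
  obtain s where s: "s \<in> W" "\<not> R u s" "\<not> R q1 s" using far_vertex[OF pw] by blast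
  note a = q2_adj[OF pw]
  have su: "s \<noteq> u" using s(2) refl up(1) by blast
  have ps: "\<not> R p s" using s(3) su dom1 pw by blast
  have ws: "\<not> R w2 s" using s(3) su dom2 qq by blast
  have ne: "s \<noteq> p" "s \<noteq> w2" "s \<noteq> q1" using s refl q up basic w a by metis+
  have c: "card {u, p, w2, q1, s} = 5" using ne su basic w up pw by auto
  have sub: "{u, p, w2, q1, s} \<subseteq> W" using basic up q s by auto
  obtain r t where rt: "r \<in> W" "t \<in> W"
    and W: "\<And>z. z \<in> W \<Longrightarrow> z = r \<or> z = t \<or> z \<in> {u, p, w2, q1, s}"
    using all_but_two[OF fin sub, of u] c card by auto
  have N: "y = s \<or> y = r \<or> y = t" if "R s y" for y
    using W[OF mem2[OF that]] that ps ws s sym by blast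
  have sr: "R s r" "R s t" using N no_leaf[OF s(1) su, of t] no_leaf[OF s(1) su, of r] by blast+
  have ru: "r \<notin> {u, w1, w2}" "t \<notin> {u, w1, w2}" using sr s ps ws pw sym by blast+
  have W': "\<And>z. z \<in> W \<Longrightarrow> z = t \<or> z = r \<or> z \<in> {u, p, w2, q1, s}" using W by blast
  \<comment> \<open>Whichever of \<open>r\<close> and \<open>t\<close> sees \<open>q1\<close> would
    be adjacent to everything outside \<open>{u, w1, w2}\<close>.\<close>
  have star: "\<not> R r t" if qr: "R q1 r \<or> R q1 t"
  proof
    assume rt': "R r t"
    have "\<exists>x\<in>{r, t}. R x q1" using qr sym by blast
    then obtain x where x: "x \<in> {r, t}" "R x q1" by blast
    then obtain y where "y \<in> W" "y \<notin> {u, w1, w2}" "\<not> R x y"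
      using not_star[of x] ru rt by blast
    then show False using W[of y] x sr rt' sym refl rt pw by blast
  qed
  show False
  proof (cases "R q1 r")
    case qr: True
    show False
    proof (cases "R q1 t")
      case True
      have "{q1, r, s, t} \<inter> {u, w1, w2} = {}" using basic su ne pw ru by auto
      moreover have "z \<in> {u, w1, w2, q1, r, s, t}" if "z \<in> W" for z
        using W[OF that] pw by blast
      ultimately show False using not_cycle[of q1 r s t] True qr star sr s sym by blast
    next
      case False
      then show False using seven_adjacent_eq_aux[OF pw qq W rt(2)] ru star qr by blast
    qed
  next
    case False
    show False
    proof (cases "R q1 t")
      case True
      then show False using seven_adjacent_eq_aux[OF pw qq W' rt(1)] ru star False sym by blast
    next
      case qt: False
      show False
      proof (rule corner[of q1 p])
        show "R p z" if "z \<in> W" "R q1 z" for z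
          using W[OF that(1)] that(2) False qt s q a basic refl[OF up(2)] sym by blast
      qed (use q up basic in auto)
    qed
  qed
qed

end

text \<open>The two pairs play equal parts, so the case \<open>p = w2\<close> reduces to
  \<open>p = w1\<close>.\<close>

lemma (in unique_trap) swap: "unique_trap W R u p w2 w1 q2 q1"
  by unfold_locales (fact fin refl sym mem nonisolated dom up unique w w(3)[symmetric] q dom1 dom2)+

lemma (in unique_trap_four) swap_four: "unique_trap_four W R u p w2 w1 q2 q1"
proof -
  interpret s: unique_trap W R u p w2 w1 q2 q1 by (rule swap)
  have i: "{u, w2, w1} = {u, w1, w2}" by blast
  show ?thesis
  proof
    show "\<exists>y\<in>W. y \<notin> {u, w2, w1} \<and> \<not> R x y" if "x \<in> W" "x \<notin> {u, w2, w1}" for x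
      using not_star[of x] that unfolding i by blast
    show False if "\<And>z. z \<in> W \<Longrightarrow> z \<in> {u, w2, w1, a, b, c, d}"
      "{a, b, c, d} \<inter> {u, w2, w1} = {}"
      "R a b" "R b c" "R c d" "R d a" "\<not> R a c" "\<not> R b d" for a b c d
      using not_cycle[of a b c d] that unfolding i by blast
  qed
qed

lemma (in unique_trap) not_card_le_six: "card W \<le> 6 \<Longrightarrow> False"
  using six_apart six_adjacent unique_trap.six_adjacent[OF swap] by blast

lemma (in unique_trap_four) not_card_le_seven: "card W \<le> 7 \<Longrightarrow> False"
  using seven_apart_eq seven_apart_neq seven_adjacent_eq seven_adjacent_neq
    unique_trap_four.seven_adjacent_eq[OF swap_four] unique_trap_four.seven_adjacent_neq[OF swap_four]
  by blast

section \<open>Capture time against one robber\<close>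

lemma two_elements:
  assumes "card W \<ge> 2"
  obtains a b where "a \<in> W" "b \<in> W" "a \<noteq> b"
proof -
  have "finite W" using assms by (metis card.infinite not_numeral_le_zero)
  moreover have "\<not> card W \<le> Suc 0" using assms by simp
  ultimately show ?thesis using card_le_Suc0_iff_eq that by metis
qed

text \<open>Only adjacency to the returning vertex \<open>u\<close> can spoil the domination. Read
  contrapositively, this determines the edges at \<open>u\<close> when \<open>u\<close> is the only
  trap.\<close>

lemma dominated_insert:
  assumes "dominated (W - {u}) E w q" "adj W E w u \<Longrightarrow> adj W E q u"
  shows "dominated W E w q"
  unfolding dominated_def
proof (intro conjI allI impI)
  fix x assume x: "adj W E w x"
  show "adj W E q x"
  proof (cases "x = u")
    case False
    then have "adj (W - {u}) E w x" using x assms(1) by (auto simp: dominated_def adj_def)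
    then show ?thesis using assms(1) adj_mono[of "W - {u}" E q x W] by (auto simp: dominated_def)
  qed (use assms x in simp)
qed (use assms(1) in \<open>auto simp: dominated_def\<close>)

lemma unique_trapI:
  assumes cw: "capture_within W E t" and sym: "symp E" and fin: "finite W"
    and u: "dominated W E u p" and uniq: "\<And>x. trap W E x \<Longrightarrow> x = u"
    and w: "dominated (W - {u}) E w1 q1" "dominated (W - {u}) E w2 q2" "w1 \<noteq> w2"
  shows "unique_trap W (adj W E) u p w1 w2 q1 q2"
proof -
  have mem: "u \<in> W" "p \<in> W" "p \<noteq> u" "w1 \<in> W - {u}" "w2 \<in> W - {u}" "q1 \<in> W - {u}" "q2 \<in> W - {u}"
    using u w by (auto simp: dominated_def)
  \<comment> \<open>Otherwise \<open>w\<close> would be dominated in \<open>W\<close> as well and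
    would be a second trap.\<close>
  have near: "adj W E u w \<and> \<not> adj W E u q" if "dominated (W - {u}) E w q" for w q
  proof (rule ccontr)
    assume "\<not> ?thesis"
    then have "adj W E w u \<Longrightarrow> adj W E q u"
      using adj_sym[OF sym, of W w u] adj_sym[OF sym, of W u q] by argo
    then have "dominated W E w q" by (rule dominated_insert[OF that])
    then have "w = u" by (rule uniq[OF dominated_trap])
    then show False using that by (simp add: dominated_def)
  qed
  have cover: "adj W E q x" if "dominated (W - {u}) E w q" "x \<noteq> u" "adj W E w x" for w q x
  proof -
    have "adj (W - {u}) E w x" using that by (auto simp: dominated_def adj_def)
    then show ?thesis
      using that(1) adj_mono[of "W - {u}" E q x W] by (auto simp: dominated_def)
  qed
  show ?thesis
  proof
    show "\<exists>y. y \<noteq> x \<and> adj W E x y" if "x \<in> W" for x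
      using capture_within_not_isolated[OF cw sym that] mem that by metis
    show "\<exists>z. adj W E x z \<and> \<not> adj W E y z" if "x \<in> W" "x \<noteq> u" "y \<in> W" "y \<noteq> x" for x y
      using uniq[of x] that by (auto simp: trap_iff dominated_def)
    show "adj W E u x \<Longrightarrow> adj W E p x" for x
      using u by (simp add: dominated_def)
    show "adj W E y x" if "adj W E x y" for x y using adj_sym[OF sym that] .
  qed (use mem near[OF w(1)] near[OF w(2)] cover w fin in \<open>simp_all add: adj_refl adj_mem\<close>)
qed

text \<open>Induction on the size. Two vertices dominate each other. In a larger graph with the
  single trap \<open>u\<close>, two traps of \<open>W - {u}\<close> would give the configuration of
  \<open>unique_trap\<close>, impossible on at most six vertices.\<close>

lemma two_traps:
  assumes "capture_within W E t" "symp E" "2 \<le> card W" "card W \<le> 6"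
  shows "\<exists>u v. u \<noteq> v \<and> trap W E u \<and> trap W E v"
  using assms
proof (induction "card W" arbitrary: W rule: less_induct)
  case less
  have fin: "finite W" using less.prems(3) by (metis card.infinite not_numeral_le_zero)
  obtain a b where ab: "a \<in> W" "b \<in> W" "a \<noteq> b"
    using two_elements[OF less.prems(3)] by blast
  then obtain u where u: "trap W E u" using capture_within_trap less.prems(1) by metis
  then obtain p where p: "dominated W E u p" by (auto simp: trap_iff)
  show ?case
  proof (rule ccontr)
    assume neg: "\<not> ?thesis"
    let ?U = "W - {u}"
    have cu: "card ?U = card W - 1" using p by (simp add: dominated_def)
    have cw: "capture_within ?U E t"
      using capture_within_retract[OF retraction_dominated[OF p] less.prems(2,1)] .
    show False
    proof (cases "card W = 2")
      case True
      then have "W = {u, p}"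
        using p fin card_seteq[of W "{u, p}"] by (auto simp: dominated_def)
      moreover have "adj W E u p" "adj W E p u" "adj W E p p"
        using p adj_refl[of u W E] adj_sym[OF less.prems(2)] adj_refl[of p W E]
        by (auto simp: dominated_def)
      ultimately have "dominated W E p u"
        using p adj_refl[of u W E] by (auto simp: dominated_def dest: adj_mem)
      then have "trap W E p" by (rule dominated_trap)
      moreover have "u \<noteq> p" using p by (auto simp: dominated_def)
      ultimately show False using neg u by blast
    next
      case False
      then have "card ?U < card W" "2 \<le> card ?U" "card ?U \<le> 6"
        using cu less.prems(3,4) by linarith+
      then obtain w1 w2 where w: "w1 \<noteq> w2" "trap ?U E w1" "trap ?U E w2"
        using less.hyps[OF _ cw less.prems(2)] by blast
      then obtain q1 q2 where q: "dominated ?U E w1 q1" "dominated ?U E w2 q2"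
        by (auto simp: trap_iff)
      interpret unique_trap W "adj W E" u p w1 w2 q1 q2
        by (rule unique_trapI[OF less.prems(1,2) fin p _ q w(1)]) (use neg u in blast)
      show False using not_card_le_six less.prems(4) by blast
    qed
  qed
qed

lemma capture_within_universal:
  assumes "x \<in> W" "\<And>y. y \<in> W \<Longrightarrow> adj W E x y"
  shows "capture_within W E (Suc 0)"
  using assms catches_adj unfolding capture_within_def by metis

text \<open>The third vertex has a neighbour among \<open>u\<close> and \<open>p\<close>, and
  \<open>p\<close> sees whatever \<open>u\<close> sees, so \<open>p\<close> is adjacent to
  everything.\<close>

lemma capture_within_three:
  assumes "capture_within W E t" "symp E" "card W = 3"
  shows "capture_within W E (Suc 0)"
proof -
  have fin: "finite W" using assms(3) by (metis card.infinite numeral_3_eq_3 nat.distinct(1))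
  obtain a b where "a \<in> W" "b \<in> W" "a \<noteq> b"
    using two_elements[of W] assms(3) by auto
  then obtain u p where up: "dominated W E u p"
    using capture_within_trap[OF assms(1)] by (meson trap_iff)
  then have m: "u \<in> W" "p \<in> W" "p \<noteq> u" by (auto simp: dominated_def)
  obtain c where c: "c \<in> W" "\<And>z. z \<in> W \<Longrightarrow> z = c \<or> z \<in> {u, p}"
    using all_but_one[OF fin, of "{u, p}" u] m assms(3) by auto
  have pu: "adj W E p u" "adj W E p p"
    using up m adj_refl[of u W E] adj_refl[of p W E] by (auto simp: dominated_def)
  have "adj W E p c"
  proof (cases "c \<in> {u, p}")
    case False
    then obtain z where z: "z \<noteq> c" "adj W E c z"
      using capture_within_not_isolated[OF assms(1,2) c(1), of u] m by auto
    then have "z \<in> {u, p}" using c(2) adj_mem by metis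
    then show ?thesis
      using z up adj_sym[OF assms(2)] by (auto simp: dominated_def)
  qed (use pu in auto)
  then have "adj W E p z" if "z \<in> W" for z
    using c(2)[OF that] pu by auto
  then show ?thesis by (rule capture_within_universal[OF m(2)])
qed

lemma capture_within_five:
  assumes "capture_within W E t" "symp E" "card W = 5"
  shows "capture_within W E 2"
proof -
  obtain u1 u2 where "u1 \<noteq> u2" "trap W E u1" "trap W E u2"
    using two_traps[OF assms(1,2)] assms(3) by auto
  then obtain u v r where r: "u \<in> W" "v \<in> W" "u \<noteq> v" "retraction W E (W - {u, v}) r"
    using two_traps_retraction[OF assms(1,2)] assms(3) by fastforce
  have "card (W - {u, v}) = 3" using r assms(3) by (simp add: card_Diff_subset)
  then have "capture_within (W - {u, v}) E (Suc 0)"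
    using capture_within_three capture_within_retract[OF r(4) assms(2,1)] assms(2) by blast
  then show ?thesis
    using capture_within_lift[OF r(4) assms(2)] by (simp add: numeral_2_eq_2)
qed

lemma capture_within_seven:
  assumes cw: "capture_within W E t" and symE: "symp E" and card: "card W = 7"
  shows "capture_within W E 3"
proof (rule ccontr)
  assume no: "\<not> ?thesis"
  have fin: "finite W" using card by (metis card.infinite zero_neq_numeral)
  obtain a b where "a \<in> W" "b \<in> W" "a \<noteq> b"
    using two_elements[of W] card by auto
  then obtain u p where udom: "dominated W E u p"
    using capture_within_trap[OF cw] by (meson trap_iff)
  have uniq: "v = u" if v: "trap W E v" for v
  proof (rule ccontr)
    assume "v \<noteq> u"
    moreover have "trap W E u" by (rule dominated_trap[OF udom])
    ultimately obtain x y r where r: "x \<in> W" "y \<in> W" "x \<noteq> y" "retraction W E (W - {x, y}) r"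
      using two_traps_retraction[OF cw symE _ v] card by fastforce
    have "card (W - {x, y}) = 5" using r card by (simp add: card_Diff_subset)
    then have "capture_within (W - {x, y}) E 2"
      using capture_within_five capture_within_retract[OF r(4) symE cw] symE by blast
    then show False
      using capture_within_lift[OF r(4) symE] no by (simp add: numeral_3_eq_3 numeral_2_eq_2)
  qed
  let ?U = "W - {u}"
  have cwU: "capture_within ?U E t"
    using capture_within_retract[OF retraction_dominated[OF udom] symE cw] .
  have "card ?U = 6" using udom card by (simp add: dominated_def)
  then obtain w1 w2 q1 q2 where wq: "dominated ?U E w1 q1" "dominated ?U E w2 q2" "w1 \<noteq> w2"
    using two_traps[OF cwU symE] by (auto simp: trap_iff)
  interpret unique_trap W "adj W E" u p w1 w2 q1 q2
    by (rule unique_trapI[OF cw symE fin udom uniq wq])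
  let ?X = "W - {u, w1, w2}"
  have X: "?U - {w1, w2} = ?X" by blast
  \<comment> \<open>Neither \<open>q1\<close> nor \<open>q2\<close> is among the deleted vertices,
    so \<open>w1\<close> and \<open>w2\<close> go in one retraction and cost one round instead of
    two.\<close>
  obtain r where r: "retraction ?U E ?X r"
    using retraction_dominated_pair[OF wq(1,2) basic(12,11)] X by auto
  have cwX: "capture_within ?X E t"
    using capture_within_retract[OF r symE cwU] .
  interpret unique_trap_four W "adj W E" u p w1 w2 q1 q2
  proof
    fix x assume x: "x \<in> W" "x \<notin> {u, w1, w2}"
    show "\<exists>y\<in>W. y \<notin> {u, w1, w2} \<and> \<not> adj W E x y"
    proof (rule ccontr)
      assume "\<not> ?thesis"
      then have "adj ?X E x y" if "y \<in> ?X" for y using that x by (auto simp: adj_def)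
      moreover have "x \<in> ?X" using x by blast
      ultimately have "capture_within ?X E (Suc 0)" by (intro capture_within_universal)
      \<comment> \<open>One round on \<open>?X\<close>, one for the return of \<open>w1\<close> and
        \<open>w2\<close>, one for the return of \<open>u\<close>.\<close>
      then have "capture_within W E (Suc (Suc (Suc 0)))"
        by (intro capture_within_lift[OF retraction_dominated[OF udom] symE]
            capture_within_lift[OF r symE])
      then show False using no by (simp add: numeral_3_eq_3)
    qed
  next
    fix a b c d
    assume W: "\<And>z. z \<in> W \<Longrightarrow> z \<in> {u, w1, w2, a, b, c, d}"
      and X: "{a, b, c, d} \<inter> {u, w1, w2} = {}"
      and e: "adj W E a b" "adj W E b c" "adj W E c d" "adj W E d a" "\<not> adj W E a c" "\<not> adj W E b d"
    have m: "a \<in> ?X" "b \<in> ?X" "c \<in> ?X" "d \<in> ?X" using X e adj_mem by fast+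
    have e': "adj W E b a" "adj W E c b" "adj W E d c" "adj W E a d" "\<not> adj W E c a" "\<not> adj W E d b"
      using e adj_sym[OF symE, of W] by blast+
    have l: "adj W E a a" "adj W E b b" "adj W E c c" "adj W E d d"
      using m by (auto intro: adj_refl)
    \<comment> \<open>As a retract with two distinct vertices, \<open>?X\<close> has a trap, but in
      an induced 4-cycle no vertex dominates another.\<close>
    have "a \<noteq> c" using e l by blast
    then obtain x y where xy: "dominated ?X E x y"
      using capture_within_trap[OF cwX m(1,3)] by (auto simp: trap_iff)
    then have xy': "x \<in> ?X" "y \<in> ?X" "x \<noteq> y" by (auto simp: dominated_def)
    have "x \<in> {a, b, c, d}" "y \<in> {a, b, c, d}" using xy' W[of x] W[of y] by blast+
    moreover have "adj W E y z" if "adj W E x z" "z \<in> ?X" for z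
    proof -
      have "adj ?X E x z" using that xy' by (simp add: adj_def)
      then have "adj ?X E y z" using xy by (simp add: dominated_def)
      then show ?thesis by (simp add: adj_def)
    qed
    ultimately show False using e e' l m xy'(3) by blast
  qed
  show False using not_card_le_seven card by simp
qed

lemma capture_within_card:
  assumes "capture_within W E t" "symp E" "card W \<ge> 7"
  shows "capture_within W E (card W - 4)"
  using assms
proof (induction "card W" arbitrary: W rule: less_induct)
  case less
  show ?case
  proof (cases "card W = 7")
    case True
    then show ?thesis using capture_within_seven less.prems by simp
  next
    case False
    have fin: "finite W" using less.prems(3) by (metis card.infinite not_numeral_le_zero)
    obtain a b where "a \<in> W" "b \<in> W" "a \<noteq> b"
      using two_elements[of W] less.prems(3) by auto
    then obtain u p where up: "dominated W E u p"
      using capture_within_trap[OF less.prems(1)] by (meson trap_iff)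
    have c: "card (W - {u}) = card W - 1" using up by (simp add: dominated_def)
    have "capture_within (W - {u}) E (card (W - {u}) - 4)"
      using less.hyps[OF _ capture_within_retract[OF retraction_dominated[OF up] less.prems(2,1)]]
        less.prems(2,3) c False by simp
    then have "capture_within W E (Suc (card (W - {u}) - 4))"
      using capture_within_lift[OF retraction_dominated[OF up] less.prems(2)] by blast
    moreover have "Suc (card (W - {u}) - 4) = card W - 4" using c less.prems(3) by linarith
    ultimately show ?thesis by simp
  qed
qed

section \<open>Several robbers\<close>

lemma all_captured_wins: "all_captured R \<Longrightarrow> cops_win_within V E t C R"
  by (cases t) auto

lemma cops_win_within_Suc:
  "cops_win_within V E t C R \<Longrightarrow> set C \<subseteq> V \<Longrightarrow> cops_win_within V E (Suc t) C R"
proof (induction t arbitrary: C R)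
  case 0
  then show ?case by simp
next
  case (Suc t)
  show ?case
  proof (cases "all_captured R")
    case False
    then obtain C' where C': "cop_moves V E C C'"
      "\<And>R'. robber_moves V E (capture C' R) R' \<Longrightarrow> cops_win_within V E t C' (capture C' R')"
      using Suc.prems(1) by auto
    have "set C' \<subseteq> V"
      using C'(1) by (auto simp: cop_moves_def in_set_conv_nth adj_def)
    then have "cops_win_within V E (Suc t) C' (capture C' R')"
      if "robber_moves V E (capture C' R) R'" for R'
      using Suc.IH C'(2)[OF that] by blast
    then show ?thesis using C'(1) by (subst cops_win_within.simps(2)) blast
  qed simp
qed

lemma cops_win_within_mono:
  "t \<le> t' \<Longrightarrow> cops_win_within V E t C R \<Longrightarrow> set C \<subseteq> V \<Longrightarrow> cops_win_within V E t' C R"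
  by (induction t' rule: dec_induct) (simp_all add: cops_win_within_Suc del: cops_win_within.simps(2))

lemma cop_moves_single: "cop_moves V E [v] C' \<longleftrightarrow> (\<exists>v'. C' = [v'] \<and> adj V E v v')"
  by (cases C') (auto simp: cop_moves_def)

lemma cops_win_within_Suc_single:
  "cops_win_within V E (Suc t) [v] R \<longleftrightarrow> all_captured R \<or> (\<exists>v'. adj V E v v' \<and>
    (\<forall>R'. robber_moves V E (capture [v'] R) R' \<longrightarrow> cops_win_within V E t [v'] (capture [v'] R')))"
  by (simp only: cops_win_within.simps(2) cop_moves_single) blast

lemma capture_single: "capture [v] [Some w] = (if w = v then [None] else [Some w])"
  by (simp add: capture_def)

lemma robber_moves_single:
  "robber_moves V E [Some w] R \<longleftrightarrow> (\<exists>y. R = [Some y] \<and> adj V E w y)"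
  by (cases R) (auto simp: robber_moves_def)

lemma robber_moves_captured: "robber_moves V E [None] R \<longleftrightarrow> R = [None]"
  by (cases R) (auto simp: robber_moves_def)

lemma cops_win_within_single:
  "cops_win_within V E t [v] (capture [v] [Some w]) \<longleftrightarrow> catches V E t v w"
proof (induction t arbitrary: v w)
  case 0
  then show ?case by (simp add: capture_single all_captured_def)
next
  case (Suc t)
  have w: "cops_win_within V E t [x] (capture [x] [None])" for x
    by (rule all_captured_wins) (simp add: all_captured_def capture_def)
  have ac: "all_captured [None]" "\<not> all_captured [Some w]" by (simp_all add: all_captured_def)
  show ?case
  proof (cases "v = w")
    case True
    then show ?thesis by (simp add: capture_single ac catches_refl)
  next
    case False
    have "cops_win_within V E (Suc t) [v] (capture [v] [Some w]) \<longleftrightarrow>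
      (\<exists>v'. adj V E v v' \<and> (\<forall>R'. robber_moves V E (capture [v'] [Some w]) R' \<longrightarrow>
        cops_win_within V E t [v'] (capture [v'] R')))"
      unfolding cops_win_within_Suc_single using False by (simp add: capture_single[of v w] ac)
    also have "\<dots> \<longleftrightarrow> (\<exists>v'. adj V E v v' \<and> (v' = w \<or>
        (\<forall>w'. adj V E w w' \<longrightarrow> catches V E t v' w')))"
    proof -
      have "(\<forall>R'. robber_moves V E (capture [v'] [Some w]) R' \<longrightarrow>
        cops_win_within V E t [v'] (capture [v'] R')) \<longleftrightarrow>
        (v' = w \<or> (\<forall>w'. adj V E w w' \<longrightarrow> catches V E t v' w'))" for v'
        by (cases "v' = w")
          (auto simp: capture_single[of v' w] capture_single[of w w] robber_moves_single robber_moves_captured w Suc.IH)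
      then show ?thesis by simp
    qed
    also have "\<dots> \<longleftrightarrow> catches V E (Suc t) v w"
      using False by (simp add: catches.simps(2))
    finally show ?thesis .
  qed
qed

lemma cop_win_capture_within:
  assumes "cop_win V E"
  shows "\<exists>t. capture_within V E t"
proof -
  obtain t C0 where C0: "length C0 = 1" "set C0 \<subseteq> V"
    "\<And>R0. valid_robber_start V 1 R0 \<Longrightarrow> cops_win_within V E t C0 (capture C0 R0)"
    using assms by (auto simp: k_cop_win_def cops_can_win_by_def)
  obtain v where v: "C0 = [v]" using C0(1) by (cases C0) auto
  have "catches V E t v w" if "w \<in> V" for w
    using C0(3)[of "[Some w]"] that
    by (simp add: v cops_win_within_single valid_robber_start_def)
  then show ?thesis using C0(2) v by (auto simp: capture_within_def)
qed

lemma good_starts_iff: "z \<in> good_starts V E t \<longleftrightarrow> z \<in> V \<and> (\<forall>w\<in>V. catches V E t z w)"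
  by (simp add: good_starts_def cops_win_within_single)

section \<open>Active robbers and the effect of a round\<close>

definition active :: "'a option list \<Rightarrow> nat set" where
  "active R = {i. i < length R \<and> R ! i \<noteq> None}"

definition placed :: "'a set \<Rightarrow> 'a option list \<Rightarrow> bool" where
  "placed V R \<longleftrightarrow> (\<forall>x. Some x \<in> set R \<longrightarrow> x \<in> V)"

lemma finite_active: "finite (active R)"
  by (simp add: active_def)

lemma active_empty: "active R = {} \<Longrightarrow> all_captured R"
  by (auto simp: active_def all_captured_def in_set_conv_nth)

lemma length_capture: "length (capture C R) = length R"
  by (simp add: capture_def)

lemma active_capture: "active (capture C R) \<subseteq> active R"
  by (auto simp: active_def capture_def split: option.splits)

lemma nth_capture:
  "i < length R \<Longrightarrow> R ! i = Some x \<Longrightarrow> capture C R ! i = (if x \<in> set C then None else Some x)"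
  by (simp add: capture_def)

lemma active_moves: "robber_moves V E R R' \<Longrightarrow> active R' = active R"
  by (auto simp: active_def robber_moves_def)

lemma placed_capture: "placed V R \<Longrightarrow> placed V (capture C R)"
  by (auto simp: placed_def capture_def split: option.splits if_splits)

lemma placed_moves:
  assumes "robber_moves V E R R'" shows "placed V R'"
  unfolding placed_def
proof (intro allI impI)
  fix x assume "Some x \<in> set R'"
  then obtain i where i: "i < length R'" "R' ! i = Some x" by (auto simp: in_set_conv_nth)
  then obtain y where "R ! i = Some y" using assms by (cases "R ! i") (auto simp: robber_moves_def)
  then show "x \<in> V" using assms i by (auto simp: robber_moves_def adj_def)
qed

lemma active_round:
  "robber_moves V E (capture C R) R' \<Longrightarrow> active (capture C R') \<subseteq> active (capture C R)"
  using active_capture active_moves by metis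

lemma cops_win_step:
  assumes "adj V E v v'"
    and "\<And>R'. robber_moves V E (capture [v'] R) R' \<Longrightarrow> cops_win_within V E t [v'] (capture [v'] R')"
  shows "cops_win_within V E (Suc t) [v] R"
  unfolding cops_win_within_Suc_single using assms by blast

text \<open>The cop follows the walk whatever the robbers do. Accidental captures only lower the
  number of active robbers, so the bound \<open>k\<close> persists.\<close>

lemma cops_win_walk:
  assumes "(x, z) \<in> {(u, v). adj V E u v} ^^ l"
    and "\<And>R. card (active R) \<le> k \<Longrightarrow> placed V R \<Longrightarrow> cops_win_within V E t [z] R"
    and "card (active R) \<le> k" "placed V R"
  shows "cops_win_within V E (l + t) [x] R"
  using assms(1,3,4)
proof (induction l arbitrary: x R)
  case 0
  then show ?case using assms(2) by simp
next
  case (Suc l)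
  obtain y where y: "adj V E x y" "(y, z) \<in> {(u, v). adj V E u v} ^^ l"
    using relpow_Suc_D2[OF Suc.prems(1)] by blast
  have "cops_win_within V E (l + t) [y] (capture [y] R')"
    if "robber_moves V E (capture [y] R) R'" for R'
  proof (rule Suc.IH[OF y(2)])
    have "active (capture [y] R') \<subseteq> active R"
      using active_round[OF that] active_capture by blast
    then show "card (active (capture [y] R')) \<le> k"
      using card_mono[OF finite_active] Suc.prems(2) le_trans by blast
    show "placed V (capture [y] R')" using placed_capture placed_moves[OF that] by blast
  qed
  then show ?case using cops_win_step[OF y(1)] by simp
qed

text \<open>Here \<open>f\<close> stands for the distance to \<open>Z\<close>, \<open>d\<close> for
  \<open>d_Z V E Z\<close> and \<open>N\<close> for the time \<open>n - 4\<close>, reduced to the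
  properties that the chase and the walk back use.\<close>

locale return_distance =
  fixes V :: "'a set" and E :: "'a \<Rightarrow> 'a \<Rightarrow> bool" and Z :: "'a set"
    and f :: "'a \<Rightarrow> nat" and d N :: nat
  assumes symE: "symp E"
    and f_adj: "adj V E x y \<Longrightarrow> f x \<le> Suc (f y)"
    and f_trap: "trap V E u \<Longrightarrow> adj V E u x \<Longrightarrow> f x \<le> d"
    and f_Z: "z \<in> Z \<Longrightarrow> f z = 0"
    and f_walk: "x \<in> V \<Longrightarrow> \<exists>z\<in>Z. (x, z) \<in> {(u, v). adj V E u v} ^^ f x"
    and Z_catches: "z \<in> Z \<Longrightarrow> w \<in> V \<Longrightarrow> catches V E N z w"
    and Z_V: "Z \<subseteq> V"
    and N: "N \<ge> 2"
begin

text \<open>As long as the robber has a move that the cop cannot answer by a capture, the cop's next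
  answer leads to a position one round closer to the end.  The last of these positions is a trap.\<close>

lemma near_trap:
  assumes "\<And>w'. adj V E w w' \<Longrightarrow> catches V E t v w'" "v \<noteq> w" "v \<in> V" "adj V E w x"
  shows "f x + 1 \<le> d + t"
  using assms
proof (induction t arbitrary: v w x)
  case 0
  have "adj V E w w" using adj_mem[OF 0(4)] by (simp add: adj_refl)
  then show ?case using 0(1)[of w] 0(2) by simp
next
  case (Suc t)
  have w: "w \<in> V" using adj_mem[OF Suc.prems(4)] by simp
  show ?case
  proof (cases "\<forall>w'. adj V E w w' \<longrightarrow> adj V E v w'")
    case True
    then have "trap V E w" using Suc.prems w by (intro dominated_trap) (auto simp: dominated_def)
    then show ?thesis using f_trap Suc.prems(4) by fastforce
  next
    case False
    then obtain w' where w': "adj V E w w'" "\<not> adj V E v w'" by blast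
    from Suc.prems(1)[OF w'(1)] obtain v' where v': "adj V E v v'" "v' \<noteq> w'"
      "\<And>w''. adj V E w' w'' \<Longrightarrow> catches V E t v' w''"
      by (cases rule: catches_Suc_cases) (use w' adj_refl[OF Suc.prems(3), of E] in auto)
    \<comment> \<open>The induction hypothesis is used for the robber at \<open>w'\<close> stepping
      back to \<open>w\<close>; the vertex \<open>x\<close> is one step from
      \<open>w\<close>.\<close>
    have "f w + 1 \<le> d + t"
      using Suc.IH[OF v'(3,2) _ adj_sym[OF symE w'(1)]] adj_mem[OF v'(1)] by blast
    moreover have "f x \<le> Suc (f w)" using f_adj adj_sym[OF symE Suc.prems(4)] by blast
    ultimately show ?thesis by simp
  qed
qed

text \<open>Of the budget, \<open>t\<close> rounds are for catching robber \<open>i\<close> and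
  \<open>c\<close> for everything after. If he is caught with \<open>e\<close> rounds to spare,
  these pay for a walk back of length up to \<open>d + e\<close>, as \<open>post\<close> states. The
  last assumption guarantees this for a capture by the next move, and \<open>near_trap\<close>
  restores it after every round. An active robber may stand on the cop's vertex when the chase
  begins; catching him takes a round, hence \<open>t > 0\<close> in that case.\<close>

lemma cops_win_chase:
  assumes post: "\<And>x R e. x \<in> V \<Longrightarrow> f x \<le> d + e \<Longrightarrow> card (active R) \<le> k \<Longrightarrow> placed V R \<Longrightarrow>
      cops_win_within V E (e + c) [x] R"
    and "i < length R" "R ! i = Some w" "v = w \<Longrightarrow> t > 0" "v \<in> V" "w \<in> V"
      "card (active R) \<le> Suc k" "placed V R" "catches V E t v w"
      "adj V E v w \<Longrightarrow> f w + 1 \<le> d + t"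
  shows "cops_win_within V E (t + c) [v] R"
  using assms(2-)
proof (induction t arbitrary: v w R)
  case 0
  then show ?case by simp
next
  case (Suc t)
  have i: "i \<in> active R" using Suc.prems(1,2) by (simp add: active_def)
  have fewer: "card (active R') \<le> k" if "active R' \<subseteq> active R" "i \<notin> active R'" for R'
  proof -
    have "card (active R') < card (active R)"
      by (rule psubset_card_mono[OF finite_active]) (use that i in blast)
    then show ?thesis using Suc.prems(6) by simp
  qed
  have round: "active (capture [x] R') \<subseteq> active R" "placed V (capture [x] R')"
    if "robber_moves V E (capture [x] R) R'" for x R'
    using active_round[OF that] active_capture placed_capture placed_moves[OF that] by blast+
  show ?case
  proof (cases "adj V E v w")
    case True
    have "cops_win_within V E (t + c) [w] (capture [w] R')"
      if R': "robber_moves V E (capture [w] R) R'" for R'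
    proof (rule post)
      have "capture [w] R ! i = None" using nth_capture[OF Suc.prems(1,2)] by simp
      then have "i \<notin> active (capture [w] R)" by (simp add: active_def)
      then show "card (active (capture [w] R')) \<le> k"
        using fewer round(1)[OF R'] active_round[OF R'] by blast
    qed (use Suc.prems(5,9) True round(2)[OF R'] in auto)
    then show ?thesis using cops_win_step[OF True] by simp
  next
    case False
    from Suc.prems(8) obtain v' where v': "adj V E v v'" "v' \<noteq> w"
      "\<And>w'. adj V E w w' \<Longrightarrow> catches V E t v' w'"
      by (cases rule: catches_Suc_cases) (use False adj_refl[OF Suc.prems(4), of E] in auto)
    have v'V: "v' \<in> V" using adj_mem[OF v'(1)] by simp
    have fx: "f x + 1 \<le> d + t" if "adj V E w x" for x
      using near_trap[OF v'(3,2) v'V that] .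
    have "cops_win_within V E (t + c) [v'] (capture [v'] R')"
      if R': "robber_moves V E (capture [v'] R) R'" for R'
    proof -
      have len: "length R' = length R"
        using R' by (simp add: robber_moves_def length_capture)
      have "capture [v'] R ! i = Some w" using nth_capture[OF Suc.prems(1,2)] v'(2) by simp
      then obtain y where y: "R' ! i = Some y" "adj V E w y"
        using R' Suc.prems(1) by (auto simp: robber_moves_def length_capture)
      have yi: "capture [v'] R' ! i = (if y = v' then None else Some y)"
        using nth_capture[of i R' y "[v']"] y(1) Suc.prems(1) len by simp
      show ?thesis
      proof (cases "y = v'")
        case True
        \<comment> \<open>The robber steps onto the cop and is caught in his own move, with
          \<open>t\<close> rounds to spare.\<close>
        then have "i \<notin> active (capture [v'] R')" using yi by (simp add: active_def)
        then have "card (active (capture [v'] R')) \<le> k" using fewer round(1)[OF R'] by blast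
        then show ?thesis using post[OF v'V] fx[OF y(2)] True round(2)[OF R'] by simp
      next
        case False
        show ?thesis
        proof (rule Suc.IH[where w = y])
          show "card (active (capture [v'] R')) \<le> Suc k"
            using card_mono[OF finite_active round(1)[OF R']] Suc.prems(6) by simp
        qed (use False yi Suc.prems(1) len y v'(3) v'V fx round(2)[OF R'] adj_mem[OF y(2)]
          in \<open>auto simp: length_capture\<close>)
      qed
    qed
    then show ?thesis using cops_win_step[OF v'(1)] by simp
  qed
qed

lemma cops_win_from_Z_step:
  assumes post: "\<And>x R e. x \<in> V \<Longrightarrow> f x \<le> d + e \<Longrightarrow> card (active R) \<le> k \<Longrightarrow> placed V R \<Longrightarrow>
      cops_win_within V E (e + c) [x] R"
    and z: "z \<in> Z" and R: "card (active R) \<le> Suc k" "placed V R"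
  shows "cops_win_within V E (N + c) [z] R"
proof (cases "active R = {}")
  case True
  then show ?thesis by (intro all_captured_wins active_empty)
next
  case False
  then obtain i w where i: "i < length R" "R ! i = Some w" by (auto simp: active_def)
  then have w: "w \<in> V" using R(2) nth_mem[OF i(1)] by (simp add: placed_def)
  show ?thesis
  proof (rule cops_win_chase[OF post i])
    \<comment> \<open>Next to \<open>z\<close> the distance to \<open>Z\<close> is at most one, so
      \<open>N \<ge> 2\<close> suffices.\<close>
    show "f w + 1 \<le> d + N" if "adj V E z w"
      using f_adj[OF adj_sym[OF symE that]] f_Z[OF z] N by simp
  qed (use Z_V z R w N Z_catches[OF z w] in auto)
qed

lemma cops_win_return:
  assumes "\<And>z R. z \<in> Z \<Longrightarrow> card (active R) \<le> k \<Longrightarrow> placed V R \<Longrightarrow> cops_win_within V E T [z] R"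
    and x: "x \<in> V" "f x \<le> d + e" and R: "card (active R) \<le> k" "placed V R"
  shows "cops_win_within V E (e + (d + T)) [x] R"
proof -
  obtain z where z: "z \<in> Z" "(x, z) \<in> {(u, v). adj V E u v} ^^ f x" using f_walk[OF x(1)] by blast
  have "cops_win_within V E (f x + T) [x] R"
    by (rule cops_win_walk[OF z(2) _ R]) (rule assms(1)[OF z(1)])
  then show ?thesis by (rule cops_win_within_mono[rotated]) (use x in auto)
qed

text \<open>No walk back follows the last capture, so \<open>Suc k\<close> robbers cost
  \<open>Suc k\<close> chases but only \<open>k\<close> returns.\<close>

lemma cops_win_from_Z:
  "z \<in> Z \<Longrightarrow> card (active R) \<le> Suc k \<Longrightarrow> placed V R \<Longrightarrow>
    cops_win_within V E (N + k * (d + N)) [z] R"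
proof (induction k arbitrary: z R)
  case (0 z R)
  show ?case
  proof (rule cops_win_from_Z_step[OF _ 0])
    show "cops_win_within V E (e + 0 * (d + N)) [x] R" if "card (active R) \<le> 0" for x R e
      using that by (intro all_captured_wins active_empty) (simp add: finite_active)
  qed
next
  case (Suc k z R)
  show ?case
  proof (rule cops_win_from_Z_step[OF _ Suc.prems])
    show "cops_win_within V E (e + Suc k * (d + N)) [x] R"
      if "x \<in> V" "f x \<le> d + e" "card (active R) \<le> Suc k" "placed V R" for x R e
      using cops_win_return[OF Suc.IH that] by (simp add: algebra_simps)
  qed
qed

end

section \<open>Distances to \<open>Z\<close> and the final bound\<close>

abbreviation steps :: "'a set \<Rightarrow> ('a \<Rightarrow> 'a \<Rightarrow> bool) \<Rightarrow> ('a \<times> 'a) set" where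
  "steps V E \<equiv> {(u, v). adj V E u v}"

lemma connected_walk:
  assumes "connected_graph V E" "\<And>u v. E u v \<Longrightarrow> u \<in> V \<and> v \<in> V" "x \<in> V" "y \<in> V"
  shows "\<exists>k. (x, y) \<in> steps V E ^^ k"
proof -
  have "(x, y) \<in> {(x, y). E x y}\<^sup>*" using assms by (simp add: connected_graph_def)
  moreover have "{(x, y). E x y} \<subseteq> steps V E" using assms(2) by (auto simp: adj_def)
  ultimately have "(x, y) \<in> (steps V E)\<^sup>*" using rtrancl_mono by blast
  then show ?thesis by (simp add: rtrancl_power)
qed

lemma set_dist_le:
  assumes "finite Z" "z \<in> Z" "(x, z) \<in> steps V E ^^ k"
  shows "set_dist V E x Z \<le> k"
proof -
  have "set_dist V E x Z \<le> graph_dist V E x z" using assms by (simp add: set_dist_def)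
  also have "\<dots> \<le> k" unfolding graph_dist_def using assms(3) by (rule Least_le)
  finally show ?thesis .
qed

lemma set_dist_walk:
  assumes "finite Z" "Z \<noteq> {}" "\<And>z. z \<in> Z \<Longrightarrow> \<exists>k. (x, z) \<in> steps V E ^^ k"
  shows "\<exists>z\<in>Z. (x, z) \<in> steps V E ^^ set_dist V E x Z"
proof -
  have "set_dist V E x Z \<in> graph_dist V E x ` Z"
    unfolding set_dist_def using assms(1,2) by (intro Min_in) auto
  then obtain z where z: "z \<in> Z" "set_dist V E x Z = graph_dist V E x z" by blast
  have "(x, z) \<in> steps V E ^^ graph_dist V E x z"
    unfolding graph_dist_def using assms(3)[OF z(1)] by (rule LeastI_ex)
  then show ?thesis using z by auto
qed

lemma set_dist_le_d_Z:
  assumes "finite V" "trap V E u" "adj V E u x"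
  shows "set_dist V E x Z \<le> d_Z V E Z"
  unfolding d_Z_def
proof (rule Max_ge)
  have "{set_dist V E x Z |x u. trap V E u \<and> x \<in> cnbhd V E u} \<subseteq> (\<lambda>x. set_dist V E x Z) ` V"
    by (auto simp: cnbhd_def adj_def)
  then show "finite {set_dist V E x Z |x u. trap V E u \<and> x \<in> cnbhd V E u}"
    using finite_subset assms(1) by blast
  show "set_dist V E x Z \<in> {set_dist V E x Z |x u. trap V E u \<and> x \<in> cnbhd V E u}"
    using assms(2,3) by (auto simp: cnbhd_def)
qed

theorem mainTheorem3:
  fixes V :: "'a set" and E :: "'a \<Rightarrow> 'a \<Rightarrow> bool" and m :: nat
  assumes "simple_graph V E" and "connected_graph V E" and "cop_win V E"
    and "card V \<ge> 7" and "m \<ge> 1"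
  shows "capt V E m \<le> d_Z V E (good_starts V E (card V - 4)) * (m - 1) + m * (card V - 4)"
proof -
  define N where "N = card V - 4"
  define Z where "Z = good_starts V E N"
  have fin: "finite V" and sym: "symp E" and inV: "\<And>u v. E u v \<Longrightarrow> u \<in> V \<and> v \<in> V"
    using assms(1) by (auto simp: simple_graph_def intro: sympI)
  obtain t where "capture_within V E t" using cop_win_capture_within[OF assms(3)] by blast
  then have "capture_within V E N"
    unfolding N_def by (rule capture_within_card[OF _ sym assms(4)])
  then obtain z0 where z0: "z0 \<in> Z"
    by (auto simp: capture_within_def Z_def good_starts_iff)
  have ZV: "Z \<subseteq> V" by (auto simp: Z_def good_starts_iff)
  then have finZ: "finite Z" using fin finite_subset by blast
  have walk: "\<exists>z\<in>Z. (x, z) \<in> steps V E ^^ set_dist V E x Z" if "x \<in> V" for x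
    using connected_walk[OF assms(2) inV that] ZV z0 by (intro set_dist_walk finZ) blast+
  interpret return_distance V E Z "\<lambda>x. set_dist V E x Z" "d_Z V E Z" N
  proof
    show "set_dist V E x Z \<le> Suc (set_dist V E y Z)" if xy: "adj V E x y" for x y
    proof -
      obtain z where "z \<in> Z" "(y, z) \<in> steps V E ^^ set_dist V E y Z"
        using walk adj_mem[OF xy] by blast
      then show ?thesis
        using xy relpow_Suc_I2[of x y "steps V E"] by (intro set_dist_le[OF finZ]) auto
    qed
    show "set_dist V E z Z = 0" if "z \<in> Z" for z
      using set_dist_le[OF finZ that, of z 0 V E] by simp
    show "catches V E N z w" if "z \<in> Z" "w \<in> V" for z w
      using that by (simp add: Z_def good_starts_iff)
  qed (use sym walk ZV assms(4) set_dist_le_d_Z[OF fin] in \<open>simp_all add: N_def\<close>)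
  have "cops_can_win_by V E 1 m (N + (m - 1) * (d_Z V E Z + N))"
    unfolding cops_can_win_by_def
  proof (intro exI[of _ "[z0]"] conjI allI impI)
    fix R0 assume R0: "valid_robber_start V m R0"
    \<comment> \<open>Round 0 may already capture some robbers; at most
      \<open>m = Suc (m - 1)\<close> remain active, so the bound from \<open>Z\<close> applies with
      \<open>k = m - 1\<close>.\<close>
    have "card (active R0) \<le> card {..<length R0}"
      by (rule card_mono) (auto simp: active_def)
    moreover have "card (active (capture [z0] R0)) \<le> card (active R0)"
      by (rule card_mono[OF finite_active active_capture])
    ultimately have "card (active (capture [z0] R0)) \<le> Suc (m - 1)"
      using R0 by (simp add: valid_robber_start_def)
    moreover have "placed V R0"
      using R0 by (fastforce simp: placed_def valid_robber_start_def in_set_conv_nth)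
    ultimately show "cops_win_within V E (N + (m - 1) * (d_Z V E Z + N)) [z0] (capture [z0] R0)"
      using cops_win_from_Z[OF z0] placed_capture by blast
  qed (use z0 ZV in auto)
  then have "capt V E m \<le> N + (m - 1) * (d_Z V E Z + N)"
    unfolding capt_l_def by (rule Least_le)
  also have "\<dots> = d_Z V E Z * (m - 1) + m * N"
    using assms(5) by (cases m) (simp_all add: algebra_simps)
  finally show ?thesis by (simp add: Z_def N_def)
qed

end
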